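(* Let $\mathcal A$ be a Banach algebra with unit $I$, let $0<T<\infty$, let $n\ge 0$ be an integer and $\alpha>1/(n+1)$. For $0\le k\le n$ and $0\le a\le b<T$ let $A^{(k)}_{ab}\in\mathcal A$, with $A^{(0)}_{ab}=I$, satisfy $$A^{(k)}_{ab}=\sum_{i=0}^kA^{(i)}_{ac}A^{(k-i)}_{cb}\qquad\text{for all }0\le a\le c\le b<T,\ k\le n,$$ and, for some constant $M$, $$|A^{(k)}_{ab}|\le M|b-a|^{k\alpha}\qquad\text{for all }0\le a\le b<T,\ k\le n.$$ For a real parameter $\lambda$ put $\mu(a,b)=\sum_{k=0}^n\lambda^kA^{(k)}_{ab}$. Then for every $\lambda\in\mathbb R$ there exists a unique multiplicative $\mathcal A$-valued function $u(a,b)$, $0\le a\le b<T$, such that $$|u(a,b)-\mu(a,b)|\le C\,|b-a|^{(n+1)\alpha}\qquad\text{for all }0\le a\le b<T$$ for some constant $C$ (which may depend on $\lambda$). Moreover there are elements $B^{(k)}_{ab}\in\mathcal A$, $k\ge n+1$, not depending on $\lambda$, such that $$u(a,b)=\sum_{k=0}^n\lambda^kA^{(k)}_{ab}+\sum_{k=n+1}^\infty\lambda^kB^{(k)}_{ab},$$ where the series is normally convergent for every $\lambda$.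
   Context: The norm of $\mathcal A$ is submultiplicative with $|I|=1$. A function $u(a,b)$ with values in $\mathcal A$ is multiplicative if $u(a,b)=u(a,c)u(c,b)$ for all $a\le c\le b$. Normal convergence means convergence of the series of (supremum) norms. *)

theory Defs
  imports "HOL-Analysis.Analysis"
begin

definition ordered_pairs :: "real \<Rightarrow> (real \<times> real) set" where
  "ordered_pairs T = {(a, b). 0 \<le> a \<and> a \<le> b \<and> b < T}"

(* Values of A outside k <= n and 0 <= a <= b < T are unconstrained.
   |b - a|^(k \<alpha>) is written (|b - a| powr \<alpha>) ^ k, because 0 powr 0 = 0 in HOL, whereas
   the bound for k = 0 and a = b must read |A 0 a a| <= M. *)
definition multiplicative_family ::
    "real \<Rightarrow> nat \<Rightarrow> real \<Rightarrow> real \<Rightarrow> (nat \<Rightarrow> real \<Rightarrow> real \<Rightarrow> 'a::real_normed_algebra_1) \<Rightarrow> bool" where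
  "multiplicative_family T n \<alpha> M A \<longleftrightarrow>
     (\<forall>a b. 0 \<le> a \<and> a \<le> b \<and> b < T \<longrightarrow> A 0 a b = 1) \<and>
     (\<forall>k\<le>n. \<forall>a c b. 0 \<le> a \<and> a \<le> c \<and> c \<le> b \<and> b < T \<longrightarrow>
        A k a b = (\<Sum>i=0..k. A i a c * A (k - i) c b)) \<and>
     (\<forall>k\<le>n. \<forall>a b. 0 \<le> a \<and> a \<le> b \<and> b < T \<longrightarrow>
        norm (A k a b) \<le> M * (\<bar>b - a\<bar> powr \<alpha>) ^ k)"

definition truncated_sum ::
    "nat \<Rightarrow> (nat \<Rightarrow> real \<Rightarrow> real \<Rightarrow> 'a::real_normed_algebra_1) \<Rightarrow> real \<Rightarrow> real \<Rightarrow> real \<Rightarrow> 'a" where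
  "truncated_sum n A lam a b = (\<Sum>k=0..n. lam ^ k *\<^sub>R A k a b)"

definition multiplicative_on ::
    "real \<Rightarrow> (real \<Rightarrow> real \<Rightarrow> 'a::real_normed_algebra_1) \<Rightarrow> bool" where
  "multiplicative_on T u \<longleftrightarrow>
     (\<forall>a c b. 0 \<le> a \<and> a \<le> c \<and> c \<le> b \<and> b < T \<longrightarrow> u a b = u a c * u c b)"

definition close_of_order ::
    "real \<Rightarrow> real \<Rightarrow> (real \<Rightarrow> real \<Rightarrow> 'a::real_normed_vector) \<Rightarrow> (real \<Rightarrow> real \<Rightarrow> 'a) \<Rightarrow> bool" where
  "close_of_order T s u \<mu> \<longleftrightarrow>
     (\<exists>C. \<forall>a b. 0 \<le> a \<and> a \<le> b \<and> b < T \<longrightarrow>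
        norm (u a b - \<mu> a b) \<le> C * \<bar>b - a\<bar> powr s)"

(* Boundedness is required explicitly because SUP of an unbounded set of reals is unspecified. *)
definition normally_convergent_on ::
    "'x set \<Rightarrow> (nat \<Rightarrow> 'x \<Rightarrow> 'a::real_normed_vector) \<Rightarrow> bool" where
  "normally_convergent_on S f \<longleftrightarrow>
     (\<forall>k. bdd_above ((\<lambda>x. norm (f k x)) ` S)) \<and>
     summable (\<lambda>k. SUP x\<in>S. norm (f k x))"

end

theory Submission
  imports Defs "HOL-Computational_Algebra.Formal_Power_Series"
begin

text \<open>
  Read the relation imposed on \<open>A\<close> as a statement about formal power series in \<open>\<lambda>\<close>: it says that
  \<open>\<Sum>k. \<lambda>\<^sup>k A\<^sup>(\<^sup>k\<^sup>) a b\<close> is multiplicative modulo \<open>\<lambda>\<^sup>n\<^sup>+\<^sup>1\<close>.  The idea, due to Lyons, is to extend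
  \<open>A\<close> degree by degree to a family \<open>X\<close> that is multiplicative in every degree and to sum the series.

  Suppose the degrees below \<open>k\<close> are known, with \<open>k > n\<close>.  The unknown term of degree \<open>k\<close> has to fail
  to be additive by exactly \<open>G a c b = (\<Sum>i=1..<k. X i a c * X (k - i) c b)\<close>.  Associativity of power
  series multiplication shows that \<open>- G 0 a b\<close> is a solution of this equation, but not one that is
  small for \<open>a\<close> close to \<open>b\<close>.  Its failure of additivity is of order \<open>k * \<alpha> > 1\<close>, so the sewing lemma
  (\<open>sewing\<close>) provides an additive function that corrects it to a small one (\<open>extension_step\<close>).

  For the series to have infinite radius of convergence the constants have to be controlled.  The
  sewing constant is bounded uniformly in the degree, and sequences of the shape \<open>c * \<rho>\<^sup>k / k\<^sup>2\<close> with
  small \<open>c\<close> reproduce themselves under the quadratic recursion for the bounds, because \<open>1 / k\<^sup>2\<close> is up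
  to a factor stable under convolution.  Hence \<open>norm (X k a b) \<le> (\<rho> * (b - a) powr \<alpha>)\<^sup>k\<close>
  (\<open>full_extension\<close>).  Taken alone this gives convergence only for short intervals \<open>[a, b]\<close>; but every
  interval is a concatenation of a bounded number of short ones, and multiplicativity turns a radius
  of convergence common to the short intervals into one for all of them (\<open>extension_decay\<close>).

  The Cauchy product makes the sum multiplicative, and its tail is of the order required.  Uniqueness
  does not depend on the construction: for two solutions \<open>u\<close>, \<open>v\<close> the function \<open>t \<mapsto> u a t * v t b\<close> has
  increments of order greater than one, hence is constant, and its end values are \<open>v a b\<close> and \<open>u a b\<close>
  (\<open>close_multiplicative_unique\<close>).
\<close>

section \<open>Additive sewing\<close>

lemma powr_power_pos:
  fixes x s :: real
  assumes "0 \<le> x" "0 < k"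
  shows "(x powr s) ^ k = x powr (real k * s)"
  using assms by (cases "x = 0") (auto simp: powr_power mult.commute)

lemma power2_powr: "(2 ^ m) powr s = (2 powr s) ^ m" for s :: real
  by (simp add: powr_power powr_powr mult.commute flip: powr_realpow)

text \<open>
  Iterating the midpoint inequality \<open>m\<close> times replaces the a priori bound by its contribution from
  \<open>2\<^sup>m\<close> intervals of length \<open>(b - a) / 2\<^sup>m\<close>, which vanishes in the limit since \<open>\<theta>' > 1\<close>.  What remains
  is a geometric series in \<open>N\<close>.  Any superlinear bound, however bad its exponent and its constant,
  thus improves to the natural one.
\<close>

lemma midpoint_bootstrap:
  fixes J :: "real \<Rightarrow> real \<Rightarrow> 'a::real_normed_vector"
  assumes \<theta>: "1 < \<theta>" and \<theta>': "1 < \<theta>'" and N: "0 \<le> N"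
    and apriori: "\<And>a b. 0 \<le> a \<Longrightarrow> a \<le> b \<Longrightarrow> b < T \<Longrightarrow> norm (J a b) \<le> K * (b - a) powr \<theta>'"
    and mid: "\<And>a b. 0 \<le> a \<Longrightarrow> a \<le> b \<Longrightarrow> b < T \<Longrightarrow>
        norm (J a b) \<le> norm (J a ((a + b) / 2)) + norm (J ((a + b) / 2) b) + N * (b - a) powr \<theta>"
    and ab: "0 \<le> a" "a \<le> b" "b < T"
  shows "norm (J a b) \<le> N / (1 - 2 powr (1 - \<theta>)) * (b - a) powr \<theta>"
proof -
  define p q where "p = (2::real) powr (1 - \<theta>)" and "q = (2::real) powr (1 - \<theta>')"
  have p: "0 < p" "p < 1" and q: "0 < q" "q < 1"
    using \<theta> \<theta>' by (auto simp: p_def q_def powr_less_one)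
  define L where "L = N / (1 - p)"
  have L: "0 \<le> L" "L * p + N = L"
    using p N by (auto simp: L_def field_simps)
  have half: "2 * ((y / 2) powr s) = 2 powr (1 - s) * y powr s" if "0 \<le> y" for y s :: real
    using that by (simp add: powr_divide powr_diff)
  have iterate: "norm (J a b) \<le> L * (b - a) powr \<theta> + K * q ^ m * (b - a) powr \<theta>'"
    if "0 \<le> a" "a \<le> b" "b < T" for m a b
    using that
  proof (induction m arbitrary: a b)
    case 0
    have "0 \<le> L * (b - a) powr \<theta>" using L by simp
    then show ?case using apriori[OF 0] by simp
  next
    case (Suc m)
    let ?c = "(a + b) / 2" and ?d = "b - a"
    have h: "?c - a = ?d / 2" "b - ?c = ?d / 2" by (auto simp: field_simps)
    have "norm (J a ?c) \<le> L * (?d / 2) powr \<theta> + K * q ^ m * (?d / 2) powr \<theta>'"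
      using Suc.IH[of a ?c] Suc.prems unfolding h by simp
    moreover have "norm (J ?c b) \<le> L * (?d / 2) powr \<theta> + K * q ^ m * (?d / 2) powr \<theta>'"
      using Suc.IH[of ?c b] Suc.prems unfolding h by simp
    ultimately have "norm (J a b) \<le> L * (2 * (?d / 2) powr \<theta>) + K * q ^ m * (2 * (?d / 2) powr \<theta>')
        + N * ?d powr \<theta>"
      using mid[OF Suc.prems] by linarith
    also have "\<dots> = L * (p * ?d powr \<theta>) + K * q ^ m * (q * ?d powr \<theta>') + N * ?d powr \<theta>"
      using Suc.prems by (simp only: half p_def q_def diff_ge_0_iff_ge)
    also have "\<dots> = (L * p + N) * ?d powr \<theta> + K * q ^ Suc m * ?d powr \<theta>'"
      by (simp add: algebra_simps)
    finally show ?case by (simp only: L)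
  qed
  have "(\<lambda>m. L * (b - a) powr \<theta> + K * q ^ m * (b - a) powr \<theta>')
      \<longlonglongrightarrow> L * (b - a) powr \<theta> + K * 0 * (b - a) powr \<theta>'"
    using q by (intro tendsto_intros LIMSEQ_realpow_zero) auto
  then have "norm (J a b) \<le> L * (b - a) powr \<theta> + K * 0 * (b - a) powr \<theta>'"
    by (rule LIMSEQ_le_const) (use iterate[OF ab] in blast)
  then show ?thesis by (simp add: L_def p_def)
qed

lemma geometric_increments:
  fixes x :: "nat \<Rightarrow> 'a::banach"
  assumes inc: "\<And>m. norm (x (Suc m) - x m) \<le> Q * r ^ m" and r: "0 \<le> r" "r < 1"
  shows "convergent x" and "norm (lim x - x 0) \<le> Q / (1 - r)"
proof -
  have geo: "(\<lambda>m. Q * r ^ m) sums (Q / (1 - r))"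
    using sums_mult[OF geometric_sums[of r], of Q] r by simp
  have sn: "summable (\<lambda>m. norm (x (Suc m) - x m))"
    by (rule summable_comparison_test'[OF sums_summable[OF geo]]) (use inc in auto)
  then have s: "summable (\<lambda>m. x (Suc m) - x m)" by (rule summable_norm_cancel)
  have "(\<lambda>m. (\<Sum>i<m. x (Suc i) - x i) + x 0) \<longlonglongrightarrow> (\<Sum>m. x (Suc m) - x m) + x 0"
    by (intro tendsto_intros summable_LIMSEQ s)
  then have lim: "x \<longlonglongrightarrow> (\<Sum>m. x (Suc m) - x m) + x 0"
    by (simp add: sum_lessThan_telescope)
  then show "convergent x" by (auto simp: convergent_def)
  have "norm (\<Sum>m. x (Suc m) - x m) \<le> (\<Sum>m. norm (x (Suc m) - x m))"
    by (rule summable_norm[OF sn])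
  also have "\<dots> \<le> Q / (1 - r)"
    using suminf_le[OF inc sn sums_summable[OF geo]] sums_unique[OF geo] by simp
  finally show "norm (lim x - x 0) \<le> Q / (1 - r)" using limI[OF lim] by simp
qed

text \<open>
  Clipping the points of one fixed grid to \<open>[a, b]\<close> gives partitions of all subintervals at once; the
  cells that miss \<open>[a, b]\<close> become degenerate instead of having to be counted.
\<close>

definition clip :: "real \<Rightarrow> real \<Rightarrow> real \<Rightarrow> real" where
  "clip a b t = max a (min b t)"

definition dyadic_sum :: "real \<Rightarrow> (real \<Rightarrow> real \<Rightarrow> 'a::real_normed_vector) \<Rightarrow> nat \<Rightarrow> real \<Rightarrow> real \<Rightarrow> 'a" where
  "dyadic_sum T F m a b =
     (\<Sum>i<2 ^ m. F (clip a b (T * real i / 2 ^ m)) (clip a b (T * real (Suc i) / 2 ^ m)))"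

lemma sum_pairs: "(\<Sum>i<2 * N. g i) = (\<Sum>i<N. g (2 * i) + g (2 * i + 1))"
  for g :: "nat \<Rightarrow> 'a::comm_monoid_add"
  by (induction N) (simp_all add: add.assoc)

text \<open>
  The additive function is the limit of Riemann sums of \<open>F\<close> over dyadic grids.  The grids do not depend
  on \<open>[a, b]\<close>, which makes additivity of the limit evident, but for a short interval the
  coarse levels contribute too much for a bound of order \<open>\<theta>\<close>.  Giving away half of the excess
  \<open>\<theta> - 1\<close> makes the levels summable, and \<open>midpoint_bootstrap\<close> then recovers the exponent
  \<open>\<theta>\<close>.  The constant decreases in \<open>\<theta>\<close>, which later allows one constant for all degrees.
\<close>

lemma sewing:
  fixes F :: "real \<Rightarrow> real \<Rightarrow> 'a::banach"
  assumes T: "0 < T" and \<theta>: "1 < \<theta>" and C: "0 \<le> C"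
    and defect: "\<And>a c b. 0 \<le> a \<Longrightarrow> a \<le> c \<Longrightarrow> c \<le> b \<Longrightarrow> b < T \<Longrightarrow>
        norm (F a b - F a c - F c b) \<le> C * (b - a) powr \<theta>"
  obtains I where
    "\<And>a c b. 0 \<le> a \<Longrightarrow> a \<le> c \<Longrightarrow> c \<le> b \<Longrightarrow> b < T \<Longrightarrow> I a b = I a c + I c b"
    "\<And>a b. 0 \<le> a \<Longrightarrow> a \<le> b \<Longrightarrow> b < T \<Longrightarrow>
        norm (I a b - F a b) \<le> C / (1 - 2 powr (1 - \<theta>)) * (b - a) powr \<theta>"
proof -
  define S where "S = dyadic_sum T F"
  define I where "I a b = lim (\<lambda>m. S m a b)" for a b
  define \<eta> where "\<eta> = (\<theta> - 1) / 2"
  define r where "r = (2 :: real) powr (- \<eta>)"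
  have \<eta>: "0 < \<eta>" and \<theta>_eq: "\<theta> = 1 + \<eta> + \<eta>" using \<theta> by (auto simp: \<eta>_def)
  have r: "0 \<le> r" "r < 1" using \<eta> by (auto simp: r_def powr_less_one)
  have diag: "F a a = 0" if "0 \<le> a" "a < T" for a
    using defect[of a a a] that by simp
  have S0: "S 0 a b = F a b" if "0 \<le> a" "a \<le> b" "b < T" for a b
    using that by (simp add: S_def dyadic_sum_def clip_def)
  have step: "norm (S (Suc m) a b - S m a b) \<le> C * T powr \<eta> * (b - a) powr (1 + \<eta>) * r ^ m"
    if ab: "0 \<le> a" "a \<le> b" "b < T" for m a b
  proof -
    define t where "t i = T * real i / 2 ^ m" for i
    define u where "u i = T * real (2 * i + 1) / 2 ^ Suc m" for i
    have tu: "t i \<le> u i" "u i \<le> t (Suc i)" "t (Suc i) - t i = T / 2 ^ m" for i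
      using T by (auto simp: t_def u_def field_simps)
    let ?x = "\<lambda>i. clip a b (t i)" and ?y = "\<lambda>i. clip a b (u i)"
    have ord: "0 \<le> ?x i" "?x i \<le> ?y i" "?y i \<le> ?x (Suc i)" "?x (Suc i) < T" for i
      using ab tu[of i] by (auto simp: clip_def)
    have len1: "?x (Suc i) - ?x i \<le> T / 2 ^ m" for i
      using ab tu[of i] by (auto simp: clip_def max_def min_def)
    have len2: "?x (Suc i) - ?x i \<le> b - a" for i
      using ab by (auto simp: clip_def max_def min_def)
    \<comment> \<open>The clipped cells still tile \<open>[a, b]\<close>, so one factor of the length may be summed exactly.\<close>
    have tot: "(\<Sum>i<2 ^ m. ?x (Suc i) - ?x i) = b - a"
    proof -
      have "(\<Sum>i<2 ^ m. ?x (Suc i) - ?x i) = ?x (2 ^ m) - ?x 0"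
        by (rule sum_lessThan_telescope)
      also have "\<dots> = b - a" using ab T by (simp add: t_def clip_def)
      finally show ?thesis .
    qed
    have Sm: "S m a b = (\<Sum>i<2 ^ m. F (?x i) (?x (Suc i)))"
      by (simp add: S_def dyadic_sum_def t_def)
    have e1: "T * real (2 * i) / 2 ^ Suc m = t i" 
      "T * real (Suc (2 * i)) / 2 ^ Suc m = u i"
      "T * real (Suc (Suc (2 * i))) / 2 ^ Suc m = t (Suc i)" for i
      by (auto simp: t_def u_def field_simps)
    have SSm: "S (Suc m) a b = (\<Sum>i<2 ^ m. F (?x i) (?y i) + F (?y i) (?x (Suc i)))"
      unfolding S_def dyadic_sum_def power_Suc sum_pairs
      by (intro sum.cong refl arg_cong2[where f = "(+)"]) (simp_all only: e1 power_Suc[symmetric] Suc_eq_plus1[symmetric])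
    have "S m a b - S (Suc m) a b = (\<Sum>i<2 ^ m. F (?x i) (?x (Suc i)) - F (?x i) (?y i) - F (?y i) (?x (Suc i)))"
      unfolding Sm SSm sum_subtractf[symmetric] by (intro sum.cong) (auto simp: algebra_simps)
    then have "norm (S (Suc m) a b - S m a b)
        = norm (\<Sum>i<2 ^ m. F (?x i) (?x (Suc i)) - F (?x i) (?y i) - F (?y i) (?x (Suc i)))"
      by (metis norm_minus_commute)
    also have "\<dots> \<le> (\<Sum>i<2 ^ m. C * ((T / 2 ^ m) powr \<eta> * (b - a) powr \<eta> * (?x (Suc i) - ?x i)))"
    proof (rule sum_norm_le)
      fix i
      let ?l = "?x (Suc i) - ?x i"
      have l0: "0 \<le> ?l" using ord[of i] by simp
      have "?l powr \<theta> = ?l powr \<eta> * ?l powr \<eta> * ?l"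
        using l0 by (simp only: \<theta>_eq powr_add powr_one mult_ac)
      also have "\<dots> \<le> (T / 2 ^ m) powr \<eta> * (b - a) powr \<eta> * ?l"
        using l0 len1[of i] len2[of i] \<eta> by (intro mult_mono powr_mono2) auto
      finally have "?l powr \<theta> \<le> (T / 2 ^ m) powr \<eta> * (b - a) powr \<eta> * ?l" .
      then show "norm (F (?x i) (?x (Suc i)) - F (?x i) (?y i) - F (?y i) (?x (Suc i)))
          \<le> C * ((T / 2 ^ m) powr \<eta> * (b - a) powr \<eta> * ?l)"
        using defect[OF ord[of i]] mult_left_mono[OF _ C] order_trans by blast
    qed
    also have "\<dots> = C * ((T / 2 ^ m) powr \<eta> * (b - a) powr \<eta> * (b - a))"
      by (simp only: tot sum_distrib_left[symmetric])
    also have "(T / 2 ^ m) powr \<eta> = T powr \<eta> * r ^ m"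
      using T by (simp add: r_def powr_divide powr_minus power2_powr power_inverse field_simps)
    finally show ?thesis
      using ab by (simp add: powr_add mult_ac)
  qed
  have conv: "(\<lambda>m. S m a b) \<longlonglongrightarrow> I a b" if "0 \<le> a" "a \<le> b" "b < T" for a b
    using geometric_increments(1)[OF step[OF that] r] by (simp add: I_def convergent_LIMSEQ_iff)
  have weak: "norm (I a b - F a b) \<le> C * T powr \<eta> / (1 - r) * (b - a) powr (1 + \<eta>)"
    if "0 \<le> a" "a \<le> b" "b < T" for a b
    using geometric_increments(2)[OF step[OF that] r] S0[OF that] by (simp add: I_def)
  have add: "I a b = I a c + I c b" if ac: "0 \<le> a" "a \<le> c" "c \<le> b" "b < T" for a c b
  proof -
    define p where "p = (2::real) powr (1 - \<theta>)"
    have p: "0 \<le> p" "p < 1" using \<theta> by (auto simp: p_def powr_less_one)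
    \<comment> \<open>Only the cell containing \<open>c\<close> can contribute.  Bounding all \<open>2\<^sup>m\<close> cells by the worst case is
      wasteful, but still tends to zero because \<open>\<theta> > 1\<close>.\<close>
    have bound: "norm (S m a b - S m a c - S m c b) \<le> C * T powr \<theta> * p ^ m" for m
    proof -
      define t where "t i = T * real i / 2 ^ m" for i
      have t: "t i \<le> t (Suc i)" "t (Suc i) - t i = T / 2 ^ m" for i
        using T by (auto simp: t_def field_simps)
      have "norm (S m a b - S m a c - S m c b)
        = norm (\<Sum>i<2 ^ m. F (clip a b (t i)) (clip a b (t (Suc i)))
            - F (clip a c (t i)) (clip a c (t (Suc i))) - F (clip c b (t i)) (clip c b (t (Suc i))))"
        by (simp add: S_def dyadic_sum_def t_def sum_subtractf)
      also have "\<dots> \<le> (\<Sum>i<(2::nat) ^ m. C * (T / 2 ^ m) powr \<theta>)"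
      proof (rule sum_norm_le)
        fix i
        let ?x = "clip a b (t i)" and ?z = "clip a b (t (Suc i))"
        let ?D = "F ?x ?z - F (clip a c (t i)) (clip a c (t (Suc i)))
            - F (clip c b (t i)) (clip c b (t (Suc i)))"
        have x: "0 \<le> ?x" "?x \<le> ?z" "?z < T" "?z - ?x \<le> T / 2 ^ m"
          using ac t[of i] by (auto simp: clip_def max_def min_def)
        consider "?z \<le> c" | "c \<le> ?x" | "?x \<le> c" "c \<le> ?z" by linarith
        then show "norm ?D \<le> C * (T / 2 ^ m) powr \<theta>"
        proof cases
          case 1
          then have "clip a c (t i) = ?x" "clip a c (t (Suc i)) = ?z"
            "clip c b (t i) = c" "clip c b (t (Suc i)) = c"
            using ac t(1)[of i] by (auto simp: clip_def max_def min_def split: if_splits)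
          then have "?D = 0" using diag[of c] ac by simp
          then show ?thesis using C by simp
        next
          case 2
          then have "clip c b (t i) = ?x" "clip c b (t (Suc i)) = ?z"
            "clip a c (t i) = c" "clip a c (t (Suc i)) = c"
            using ac t(1)[of i] by (auto simp: clip_def max_def min_def split: if_splits)
          then have "?D = 0" using diag[of c] ac by simp
          then show ?thesis using C by simp
        next
          case 3
          then have "clip a c (t i) = ?x" "clip a c (t (Suc i)) = c"
            "clip c b (t i) = c" "clip c b (t (Suc i)) = ?z"
            using ac t(1)[of i] by (auto simp: clip_def max_def min_def split: if_splits)
          then have "norm ?D \<le> C * (?z - ?x) powr \<theta>" using defect[OF x(1) 3 x(3)] by simp
          also have "\<dots> \<le> C * (T / 2 ^ m) powr \<theta>"
            using x C \<theta> by (intro mult_left_mono powr_mono2) auto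
          finally show ?thesis .
        qed
      qed
      also have "\<dots> = C * T powr \<theta> * p ^ m"
      proof -
        have "p ^ m = 2 ^ m / (2 ^ m) powr \<theta>"
          by (simp add: p_def powr_diff power_divide power2_powr)
        then show ?thesis using T by (simp add: powr_divide)
      qed
      finally show ?thesis .
    qed
    have l: "(\<lambda>m. S m a b - S m a c - S m c b) \<longlonglongrightarrow> I a b - I a c - I c b"
      using ac by (intro tendsto_diff conv) auto
    have "(\<lambda>m. C * T powr \<theta> * p ^ m) \<longlonglongrightarrow> C * T powr \<theta> * 0"
      using p by (intro tendsto_intros LIMSEQ_realpow_zero) auto
    then have null: "(\<lambda>m. C * T powr \<theta> * p ^ m) \<longlonglongrightarrow> 0" by simp
    have "(\<lambda>m. S m a b - S m a c - S m c b) \<longlonglongrightarrow> 0"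
      by (rule Lim_null_comparison[OF _ null]) (simp add: bound)
    then have "I a b - I a c - I c b = 0" using l LIMSEQ_unique by blast
    then show ?thesis by (simp add: algebra_simps)
  qed
  show ?thesis
  proof (rule that[OF add])
    fix a b assume ab: "0 \<le> a" "a \<le> b" "b < T"
    have "norm (I a b - F a b) \<le> norm (I a c - F a c) + norm (I c b - F c b) + C * (b - a) powr \<theta>"
      if "0 \<le> a" "a \<le> b" "b < T" "c = (a + b) / 2" for a b c
    proof -
      have c: "a \<le> c" "c \<le> b" using that by auto
      have "I a b - F a b = (I a c - F a c) + (I c b - F c b) - (F a b - F a c - F c b)"
        using add[OF that(1) c that(3)] by simp
      then have "norm (I a b - F a b)
          \<le> norm ((I a c - F a c) + (I c b - F c b)) + norm (F a b - F a c - F c b)"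
        by (simp only: norm_triangle_ineq4)
      then show ?thesis
        using defect[OF that(1) c that(3)] norm_triangle_ineq[of "I a c - F a c" "I c b - F c b"]
        by linarith
    qed
    then show "norm (I a b - F a b) \<le> C / (1 - 2 powr (1 - \<theta>)) * (b - a) powr \<theta>"
      using midpoint_bootstrap[where J = "\<lambda>a b. I a b - F a b", OF \<theta> _ C weak _ ab] \<eta> by simp
  qed
qed


section \<open>Extension to higher degrees\<close>

lemma fps_nth_mult_lowest:
  fixes P D :: "'a::ring_1 fps"
  assumes "\<And>i. i < k \<Longrightarrow> fps_nth D i = 0"
  shows "fps_nth (P * D) k = fps_nth P 0 * fps_nth D k"
    and "fps_nth (D * P) k = fps_nth D k * fps_nth P 0"
proof -
  have "fps_nth (P * D) k = (\<Sum>i\<in>{0}. fps_nth P i * fps_nth D (k - i))"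
    unfolding fps_mult_nth using assms[of "k - i" for i] by (intro sum.mono_neutral_right) auto
  then show "fps_nth (P * D) k = fps_nth P 0 * fps_nth D k" by simp
  have "fps_nth (D * P) k = (\<Sum>i\<in>{k}. fps_nth D i * fps_nth P (k - i))"
    unfolding fps_mult_nth using assms by (intro sum.mono_neutral_right) auto
  then show "fps_nth (D * P) k = fps_nth D k * fps_nth P 0" by simp
qed

lemma sum_split_ends:
  fixes g :: "nat \<Rightarrow> 'a::ab_group_add"
  assumes "0 < k"
  shows "(\<Sum>i=0..k. g i) = g 0 + g k + (\<Sum>i=1..<k. g i)"
proof -
  have "{0..k} = insert 0 (insert k {1..<k})" using assms by auto
  then show ?thesis using assms by (simp add: algebra_simps)
qed

text \<open>
  The germ \<open>F a b\<close> handed to \<open>sewing\<close> is what the increment of \<open>f k 0\<close> over \<open>[a, b]\<close> would have to be up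
  to the unknown \<open>f k a b\<close> itself.  To compute its defect, let \<open>X a b\<close> be the series of the known terms,
  with coefficient \<open>0\<close> in degree \<open>k\<close>.  Then \<open>X a c * X c b\<close> differs from \<open>X a b\<close> first in degree \<open>k\<close>,
  and there by \<open>G a c b\<close>; comparing both bracketings of \<open>X 0 a * X a c * X c b\<close> in degree \<open>k\<close> yields
  the defect \<open>- G a c b\<close>.
\<close>

lemma extension_step:
  fixes f :: "nat \<Rightarrow> real \<Rightarrow> real \<Rightarrow> 'a::{real_normed_algebra_1, banach}"
  assumes T: "0 < T" and k: "0 < k" and \<theta>: "1 < \<theta>" and C: "0 \<le> C"
    and f0: "\<And>a b. 0 \<le> a \<Longrightarrow> a \<le> b \<Longrightarrow> b < T \<Longrightarrow> f 0 a b = 1"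
    and chen: "\<And>i a c b. i < k \<Longrightarrow> 0 \<le> a \<Longrightarrow> a \<le> c \<Longrightarrow> c \<le> b \<Longrightarrow> b < T \<Longrightarrow>
        f i a b = (\<Sum>j=0..i. f j a c * f (i - j) c b)"
    and bound: "\<And>a c b. 0 \<le> a \<Longrightarrow> a \<le> c \<Longrightarrow> c \<le> b \<Longrightarrow> b < T \<Longrightarrow>
        norm (\<Sum>i=1..<k. f i a c * f (k - i) c b) \<le> C * (b - a) powr \<theta>"
  obtains r where
    "\<And>a c b. 0 \<le> a \<Longrightarrow> a \<le> c \<Longrightarrow> c \<le> b \<Longrightarrow> b < T \<Longrightarrow>
        r a b = r a c + r c b + (\<Sum>i=1..<k. f i a c * f (k - i) c b)"
    "\<And>a b. 0 \<le> a \<Longrightarrow> a \<le> b \<Longrightarrow> b < T \<Longrightarrow>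
        norm (r a b) \<le> C / (1 - 2 powr (1 - \<theta>)) * (b - a) powr \<theta>"
proof -
  define X where "X a b = Abs_fps (\<lambda>i. if i < k then f i a b else 0)" for a b
  define G where "G a c b = (\<Sum>i=1..<k. f i a c * f (k - i) c b)" for a c b
  define F where "F a b = G 0 a b" for a b
  have G: "fps_nth (X a c * X c b) k = G a c b" for a c b
    unfolding fps_mult_nth sum_split_ends[OF k] using k by (simp add: X_def G_def)
  have X0: "fps_nth (X a b) 0 = 1" if "0 \<le> a" "a \<le> b" "b < T" for a b
    using that k f0 by (simp add: X_def)
  have low: "fps_nth (X a c * X c b - X a b) i = 0"
    if "0 \<le> a" "a \<le> c" "c \<le> b" "b < T" "i < k" for a c b i
    using that chen[of i a c b] by (auto simp: fps_mult_nth X_def intro!: sum.cong)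
  have top: "fps_nth (X a c * X c b - X a b) k = G a c b" for a c b
    using G[of a c b] by (simp add: X_def)
  have defect: "F a b - F a c - F c b = - G a c b"
    if ac: "0 \<le> a" "a \<le> c" "c \<le> b" "b < T" for a c b
  proof -
    define D E where "D = X 0 a * X a c - X 0 c" and "E = X a c * X c b - X a b"
    have D: "fps_nth (D * X c b) k = F a c"
      using ac low[of 0 a c] top[of 0 a c] X0[of c b]
      by (subst fps_nth_mult_lowest) (auto simp: D_def F_def)
    have E: "fps_nth (X 0 a * E) k = G a c b"
      using ac low[of a c b] top[of a c b] X0[of 0 a]
      by (subst fps_nth_mult_lowest) (auto simp: E_def)
    have "(X 0 c + D) * X c b = X 0 a * (X a b + E)"
      by (simp add: D_def E_def mult.assoc)
    then have "fps_nth (X 0 c * X c b) k + fps_nth (D * X c b) k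
        = fps_nth (X 0 a * X a b) k + fps_nth (X 0 a * E) k"
      by (metis distrib_left distrib_right fps_add_nth)
    then have "F c b + F a c = F a b + G a c b" by (simp add: D E G F_def)
    then show ?thesis by (simp add: algebra_simps)
  qed
  have small: "norm (F a b - F a c - F c b) \<le> C * (b - a) powr \<theta>"
    if "0 \<le> a" "a \<le> c" "c \<le> b" "b < T" for a c b
    using bound[OF that] defect[OF that] by (simp add: G_def)
  obtain I where add: "\<And>a c b. 0 \<le> a \<Longrightarrow> a \<le> c \<Longrightarrow> c \<le> b \<Longrightarrow> b < T \<Longrightarrow> I a b = I a c + I c b"
    and close: "\<And>a b. 0 \<le> a \<Longrightarrow> a \<le> b \<Longrightarrow> b < T \<Longrightarrow>
        norm (I a b - F a b) \<le> C / (1 - 2 powr (1 - \<theta>)) * (b - a) powr \<theta>"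
    using sewing[OF T \<theta> C small] by blast
  show ?thesis
  proof (rule that[of "\<lambda>a b. I a b - F a b"])
    fix a c b assume ac: "0 \<le> a" "a \<le> c" "c \<le> b" "b < T"
    show "I a b - F a b = (I a c - F a c) + (I c b - F c b) + (\<Sum>i=1..<k. f i a c * f (k - i) c b)"
      using defect[OF ac] add[OF ac] by (simp add: G_def algebra_simps)
  qed (fact close)
qed

lemma sum_inverse_squares_le: "(\<Sum>i=1..<k. 1 / (real i)\<^sup>2) \<le> 2"
proof -
  have "(\<Sum>i=1..<Suc (Suc m). 1 / (real i)\<^sup>2) \<le> 2 - 1 / real (Suc m)" for m
  proof (induction m)
    case (Suc m)
    have "1 / (real (Suc (Suc m)))\<^sup>2 \<le> 1 / (real (Suc m) * real (Suc (Suc m)))"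
      unfolding power2_eq_square by (intro frac_le mult_right_mono) auto
    also have "\<dots> = 1 / real (Suc m) - 1 / real (Suc (Suc m))"
      by (simp add: field_simps)
    finally show ?case using Suc by simp
  qed simp
  then have *: "(\<Sum>i=1..<Suc (Suc m). 1 / (real i)\<^sup>2) \<le> 2" for m
    by (rule order_trans) simp
  have "(\<Sum>i=1..<k. 1 / (real i)\<^sup>2) \<le> (\<Sum>i=1..<Suc (Suc k). 1 / (real i)\<^sup>2)"
    by (rule sum_mono2) auto
  with *[of k] show ?thesis by linarith
qed

text \<open>
  In each term one of \<open>i\<close> and \<open>k - i\<close> is at least \<open>k / 2\<close>.  The identity
  \<open>1 / (x * y) = (1 / x + 1 / y) / (x + y)\<close> expresses this without a case distinction.
\<close>

lemma convolution_inverse_squares_le: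
  assumes k: "0 < k"
  shows "(\<Sum>i=1..<k. 1 / ((real i)\<^sup>2 * (real (k - i))\<^sup>2)) \<le> 8 / (real k)\<^sup>2"
proof -
  have pointwise: "1 / ((real i)\<^sup>2 * (real (k - i))\<^sup>2)
      \<le> 2 / (real k)\<^sup>2 * (1 / (real i)\<^sup>2 + 1 / (real (k - i))\<^sup>2)" if "i \<in> {1..<k}" for i
  proof -
    define x y where "x = real i" and "y = real (k - i)"
    have xy: "0 < x" "0 < y" "real k = x + y" using that by (auto simp: x_def y_def)
    have "(x + y)\<^sup>2 \<le> 2 * (x\<^sup>2 + y\<^sup>2)" using sum_squares_bound[of x y] by (simp add: power2_sum)
    then have "1 / (x\<^sup>2 * y\<^sup>2) \<le> 2 / (x + y)\<^sup>2 * (1 / x\<^sup>2 + 1 / y\<^sup>2)"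
      using xy by (simp add: divide_simps algebra_simps)
    then show ?thesis by (simp add: xy x_def[symmetric] y_def[symmetric])
  qed
  have rev: "(\<Sum>i=1..<k. 1 / (real (k - i))\<^sup>2) = (\<Sum>i=1..<k. 1 / (real i)\<^sup>2)"
    by (rule sum.reindex_bij_witness[of _ "\<lambda>i. k - i" "\<lambda>i. k - i"]) auto
  have "(\<Sum>i=1..<k. 1 / ((real i)\<^sup>2 * (real (k - i))\<^sup>2))
      \<le> (\<Sum>i=1..<k. 2 / (real k)\<^sup>2 * (1 / (real i)\<^sup>2 + 1 / (real (k - i))\<^sup>2))"
    by (rule sum_mono[OF pointwise])
  also have "\<dots> = 2 / (real k)\<^sup>2 * (2 * (\<Sum>i=1..<k. 1 / (real i)\<^sup>2))"
    by (simp only: sum_distrib_left[symmetric] sum.distrib rev mult_2)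
  also have "\<dots> \<le> 2 / (real k)\<^sup>2 * (2 * 2)"
    using sum_inverse_squares_le[of k] by (intro mult_left_mono) auto
  finally show ?thesis by simp
qed

text \<open>
  The recursion is carried by the bound \<open>c * (\<rho> * (b - a) powr \<alpha>)\<^sup>k / k\<^sup>2\<close>.  The factor \<open>c\<close> enters
  quadratically on the right of the recursion and linearly on the left, so it can be chosen small
  enough to absorb both the sewing constant and the \<open>8\<close> of \<open>convolution_inverse_squares_le\<close>; afterwards
  \<open>\<rho>\<close> is taken large enough for the given degrees \<open>1, \<dots>, n\<close>.
\<close>

lemma full_extension:
  fixes A :: "nat \<Rightarrow> real \<Rightarrow> real \<Rightarrow> 'a::{real_normed_algebra_1, banach}"
  assumes T: "0 < T" and \<alpha>: "1 < (real n + 1) * \<alpha>" and mf: "multiplicative_family T n \<alpha> M A"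
  obtains \<rho> and X :: "nat \<Rightarrow> real \<Rightarrow> real \<Rightarrow> 'a" where
    "0 \<le> \<rho>"
    "\<And>k. k \<le> n \<Longrightarrow> X k = A k"
    "\<And>k a c b. 0 \<le> a \<Longrightarrow> a \<le> c \<Longrightarrow> c \<le> b \<Longrightarrow> b < T \<Longrightarrow>
        X k a b = (\<Sum>i=0..k. X i a c * X (k - i) c b)"
    "\<And>k a b. 0 < k \<Longrightarrow> 0 \<le> a \<Longrightarrow> a \<le> b \<Longrightarrow> b < T \<Longrightarrow> norm (X k a b) \<le> (\<rho> * (b - a) powr \<alpha>) ^ k"
proof -
  have A0: "A 0 a b = 1" if "0 \<le> a" "a \<le> b" "b < T" for a b
    using mf that by (auto simp: multiplicative_family_def)
  have A_chen: "A k a b = (\<Sum>i=0..k. A i a c * A (k - i) c b)"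
    if "k \<le> n" "0 \<le> a" "a \<le> c" "c \<le> b" "b < T" for k a c b
    using mf that unfolding multiplicative_family_def by blast
  have A_bound: "norm (A k a b) \<le> M * ((b - a) powr \<alpha>) ^ k"
    if "k \<le> n" "0 \<le> a" "a \<le> b" "b < T" for k a b
    using mf that unfolding multiplicative_family_def by (metis abs_of_nonneg diff_ge_0_iff_ge)
  have M: "1 \<le> M" using A_bound[of 0 0 0] A0[of 0 0] T by simp
  define c where "c = (1 - 2 powr (1 - (real n + 1) * \<alpha>)) / 8"
  have c: "0 < c" "c \<le> 1"
    using \<alpha> by (auto simp: c_def powr_less_one) (smt (verit) powr_ge_zero)
  define \<rho> where "\<rho> = max 1 (M * (real n)\<^sup>2 / c)"
  define bounded where "bounded k r \<longleftrightarrow> (\<forall>a b. 0 \<le> a \<longrightarrow> a \<le> b \<longrightarrow> b < T \<longrightarrow>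
      norm (r a b) \<le> c * (\<rho> * (b - a) powr \<alpha>) ^ k / (real k)\<^sup>2)"
    for k and r :: "real \<Rightarrow> real \<Rightarrow> 'a"
  \<comment> \<open>\<open>r\<close> is an admissible term of degree \<open>k\<close>, given the terms \<open>f i\<close> with \<open>i < k\<close>.  The summands with
    \<open>i = 0\<close> and \<open>i = k\<close> are written out as \<open>r\<close>, because the choice principle used below does not let
    \<open>P f k r\<close> depend on \<open>f k\<close>.\<close>
  define P where "P f k r \<longleftrightarrow> (k \<le> n \<longrightarrow> r = A k) \<and> (\<not> k \<le> n \<longrightarrow> bounded k r \<and>
      (\<forall>a s b. 0 \<le> a \<longrightarrow> a \<le> s \<longrightarrow> s \<le> b \<longrightarrow> b < T \<longrightarrow>
        r a b = r a s + r s b + (\<Sum>i=1..<k. f i a s * f (k - i) s b)))"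
    for f :: "nat \<Rightarrow> real \<Rightarrow> real \<Rightarrow> 'a" and k r
  have \<rho>: "1 \<le> \<rho>" by (simp add: \<rho>_def)
  have bounded_A: "bounded k (A k)" if "0 < k" "k \<le> n" for k
    unfolding bounded_def
  proof (intro allI impI)
    fix a b assume ab: "0 \<le> a" "a \<le> b" "b < T"
    have "M * (real k)\<^sup>2 / c \<le> M * (real n)\<^sup>2 / c"
      using that M c by (intro divide_right_mono mult_left_mono power_mono) auto
    also have "\<dots> \<le> \<rho> ^ 1" by (simp add: \<rho>_def)
    also have "\<dots> \<le> \<rho> ^ k" using \<rho> that by (intro power_increasing) auto
    finally have "M \<le> c * \<rho> ^ k / (real k)\<^sup>2"
      using c that by (simp add: field_simps)
    then have "M * ((b - a) powr \<alpha>) ^ k \<le> c * \<rho> ^ k / (real k)\<^sup>2 * ((b - a) powr \<alpha>) ^ k"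
      by (intro mult_right_mono) auto
    then show "norm (A k a b) \<le> c * (\<rho> * (b - a) powr \<alpha>) ^ k / (real k)\<^sup>2"
      using A_bound[OF that(2) ab] by (simp add: power_mult_distrib)
  qed
  have P_bounded: "bounded k r" if "P f k r" "0 < k" for f k r
    using that bounded_A unfolding P_def by blast
  have P_chen: "f k a b = (\<Sum>i=0..k. f i a s * f (k - i) s b)"
    if P: "\<And>i. i \<le> k \<Longrightarrow> P f i (f i)" and as: "0 \<le> a" "a \<le> s" "s \<le> b" "b < T" for f k a s b
  proof (cases "k \<le> n")
    case True
    then have "f i = A i" if "i \<le> k" for i using P[of i] that by (simp add: P_def)
    then show ?thesis using A_chen[OF True as] by simp
  next
    case False
    have "f 0 = A 0" using P[of 0] by (simp add: P_def)
    then have "f 0 a s = 1" "f 0 s b = 1" using as A0 by auto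
    moreover have "f k a b = f k a s + f k s b + (\<Sum>i=1..<k. f i a s * f (k - i) s b)"
      using P[of k] False as unfolding P_def by blast
    ultimately show ?thesis using False by (simp add: sum_split_ends)
  qed
  have "\<exists>X. \<forall>k. P X k (X k)"
  proof (rule dependent_wellorder_choice)
    fix r and f g :: "nat \<Rightarrow> real \<Rightarrow> real \<Rightarrow> 'a" and k
    assume eq: "\<And>i. i < k \<Longrightarrow> f i = g i"
    have "(\<Sum>i=1..<k. f i a s * f (k - i) s b) = (\<Sum>i=1..<k. g i a s * g (k - i) s b)" for a s b
      by (intro sum.cong) (auto simp: eq)
    then show "P f k r = P g k r" by (simp only: P_def)
  next
    fix k and f :: "nat \<Rightarrow> real \<Rightarrow> real \<Rightarrow> 'a"
    assume prev: "\<And>i. i < k \<Longrightarrow> P f i (f i)"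
    show "\<exists>r. P f k r"
    proof (cases "k \<le> n")
      case True
      then show ?thesis by (auto simp: P_def)
    next
      case False
      then have k: "0 < k" by simp
      define \<theta> where "\<theta> = real k * \<alpha>"
      have \<alpha>0: "0 < \<alpha>" using \<alpha> by (smt (verit) of_nat_0_le_iff zero_less_mult_pos)
      have \<theta>_ge: "(real n + 1) * \<alpha> \<le> \<theta>"
        using False \<alpha>0 by (auto simp: \<theta>_def intro!: mult_right_mono)
      then have \<theta>: "1 < \<theta>" using \<alpha> by linarith
      define C where "C = 8 * c\<^sup>2 * \<rho> ^ k / (real k)\<^sup>2"
      have C: "0 \<le> C" using \<rho> by (simp add: C_def)
      have "norm (\<Sum>i=1..<k. f i a s * f (k - i) s b) \<le> C * (b - a) powr \<theta>"
        if as: "0 \<le> a" "a \<le> s" "s \<le> b" "b < T" for a s b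
      proof -
        let ?y = "\<rho> * (b - a) powr \<alpha>"
        have "norm (f i a s * f (k - i) s b) \<le> c\<^sup>2 * ?y ^ k * (1 / ((real i)\<^sup>2 * (real (k - i))\<^sup>2))"
          if i: "i \<in> {1..<k}" for i
        proof -
          have "norm (f i a s) \<le> c * (\<rho> * (s - a) powr \<alpha>) ^ i / (real i)\<^sup>2"
            using P_bounded[OF prev, of i] i as by (auto simp: bounded_def)
          also have "\<dots> \<le> c * ?y ^ i / (real i)\<^sup>2"
            using as c \<rho> \<alpha>0 by (intro divide_right_mono mult_left_mono power_mono powr_mono2) auto
          finally have 1: "norm (f i a s) \<le> c * ?y ^ i / (real i)\<^sup>2" .
          have "norm (f (k - i) s b) \<le> c * (\<rho> * (b - s) powr \<alpha>) ^ (k - i) / (real (k - i))\<^sup>2"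
            using P_bounded[OF prev, of "k - i"] i as by (auto simp: bounded_def)
          also have "\<dots> \<le> c * ?y ^ (k - i) / (real (k - i))\<^sup>2"
            using as c \<rho> \<alpha>0 by (intro divide_right_mono mult_left_mono power_mono powr_mono2) auto
          finally have 2: "norm (f (k - i) s b) \<le> c * ?y ^ (k - i) / (real (k - i))\<^sup>2" .
          have "norm (f i a s * f (k - i) s b)
              \<le> (c * ?y ^ i / (real i)\<^sup>2) * (c * ?y ^ (k - i) / (real (k - i))\<^sup>2)"
            using c \<rho> by (intro order_trans[OF norm_mult_ineq] mult_mono 1 2) auto
          also have "\<dots> = c\<^sup>2 * (?y ^ i * ?y ^ (k - i)) * (1 / ((real i)\<^sup>2 * (real (k - i))\<^sup>2))"
            by (simp add: power2_eq_square)
          also have "?y ^ i * ?y ^ (k - i) = ?y ^ k"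
            using i by (simp flip: power_add)
          finally show ?thesis .
        qed
        then have "norm (\<Sum>i=1..<k. f i a s * f (k - i) s b)
            \<le> (\<Sum>i=1..<k. c\<^sup>2 * ?y ^ k * (1 / ((real i)\<^sup>2 * (real (k - i))\<^sup>2)))"
          by (rule sum_norm_le)
        also have "\<dots> \<le> c\<^sup>2 * ?y ^ k * (8 / (real k)\<^sup>2)"
          unfolding sum_distrib_left[symmetric] using \<rho>
          by (intro mult_left_mono convolution_inverse_squares_le k) auto
        also have "?y ^ k = \<rho> ^ k * (b - a) powr \<theta>"
          using as k by (simp add: power_mult_distrib powr_power_pos \<theta>_def)
        finally show ?thesis by (simp add: C_def mult_ac)
      qed
      moreover have "f 0 a b = 1" if "0 \<le> a" "a \<le> b" "b < T" for a b
        using prev[OF k] A0[OF that] by (simp add: P_def)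
      moreover have "f i a b = (\<Sum>j=0..i. f j a s * f (i - j) s b)"
        if "i < k" "0 \<le> a" "a \<le> s" "s \<le> b" "b < T" for i a s b
        using that by (intro P_chen prev) auto
      ultimately obtain r where
        add: "\<And>a s b. 0 \<le> a \<Longrightarrow> a \<le> s \<Longrightarrow> s \<le> b \<Longrightarrow> b < T \<Longrightarrow>
            r a b = r a s + r s b + (\<Sum>i=1..<k. f i a s * f (k - i) s b)"
        and le: "\<And>a b. 0 \<le> a \<Longrightarrow> a \<le> b \<Longrightarrow> b < T \<Longrightarrow>
            norm (r a b) \<le> C / (1 - 2 powr (1 - \<theta>)) * (b - a) powr \<theta>"
        using extension_step[OF T k \<theta> C, of f] by blast
      have "(2::real) powr (1 - \<theta>) \<le> 2 powr (1 - (real n + 1) * \<alpha>)"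
        using \<theta>_ge by (intro powr_mono) auto
      then have c8: "8 * c \<le> 1 - 2 powr (1 - \<theta>)" by (simp add: c_def)
      have "C / (1 - 2 powr (1 - \<theta>)) \<le> C / (8 * c)"
        using c C c8 by (intro divide_left_mono) auto
      also have "\<dots> = c * \<rho> ^ k / (real k)\<^sup>2"
        using c by (simp add: C_def power2_eq_square)
      finally have const: "C / (1 - 2 powr (1 - \<theta>)) \<le> c * \<rho> ^ k / (real k)\<^sup>2" .
      have "bounded k r"
        unfolding bounded_def
      proof (intro allI impI)
        fix a b assume ab: "0 \<le> a" "a \<le> b" "b < T"
        have "norm (r a b) \<le> c * \<rho> ^ k / (real k)\<^sup>2 * (b - a) powr \<theta>"
          using le[OF ab] mult_right_mono[OF const, of "(b - a) powr \<theta>"] by simp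
        then show "norm (r a b) \<le> c * (\<rho> * (b - a) powr \<alpha>) ^ k / (real k)\<^sup>2"
          using ab k by (simp add: power_mult_distrib powr_power_pos \<theta>_def)
      qed
      then show ?thesis using add False unfolding P_def by blast
    qed
  qed
  then obtain X where X: "\<And>k. P X k (X k)" by blast
  show ?thesis
  proof (rule that[of \<rho> X])
    fix k :: nat and a b assume k: "0 < k" and ab: "0 \<le> a" "a \<le> b" "b < T"
    have "1 \<le> (real k)\<^sup>2" using k by simp
    then have "c / (real k)\<^sup>2 \<le> 1" using c by (simp add: divide_le_eq)
    then have "c / (real k)\<^sup>2 * (\<rho> * (b - a) powr \<alpha>) ^ k \<le> 1 * (\<rho> * (b - a) powr \<alpha>) ^ k"
      using \<rho> by (intro mult_right_mono) auto
    then show "norm (X k a b) \<le> (\<rho> * (b - a) powr \<alpha>) ^ k"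
      using P_bounded[OF X k] ab by (fastforce simp: bounded_def)
  next
    show "X k = A k" if "k \<le> n" for k using X[of k] that by (simp add: P_def)
  qed (use \<rho> in simp, fact P_chen[OF X])
qed


section \<open>Uniqueness\<close>

text \<open>
  This is \<open>midpoint_bootstrap\<close> for the increments of \<open>w\<close>, which are additive: with \<open>N = 0\<close> the improved
  bound vanishes.  Clipping extends the increments beyond \<open>[a, b]\<close>.
\<close>

lemma superlinear_imp_eq:
  fixes w :: "real \<Rightarrow> 'a::real_normed_vector"
  assumes \<theta>: "1 < \<theta>" and K: "0 \<le> K" and ab: "0 \<le> a" "a \<le> b"
    and inc: "\<And>s t. a \<le> s \<Longrightarrow> s \<le> t \<Longrightarrow> t \<le> b \<Longrightarrow> norm (w t - w s) \<le> K * (t - s) powr \<theta>"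
  shows "w b = w a"
proof -
  define J where "J s t = w (clip a b t) - w (clip a b s)" for s t
  have "norm (J s t) \<le> K * (t - s) powr \<theta>" if "s \<le> t" for s t
  proof -
    have "norm (J s t) \<le> K * (clip a b t - clip a b s) powr \<theta>"
      unfolding J_def using ab that by (intro inc) (auto simp: clip_def)
    also have "\<dots> \<le> K * (t - s) powr \<theta>"
      using that K \<theta> by (intro mult_left_mono powr_mono2) (auto simp: clip_def)
    finally show ?thesis .
  qed
  moreover have "norm (J s t) \<le> norm (J s m) + norm (J m t) + 0 * (t - s) powr \<theta>" for s m t
    using norm_triangle_ineq[of "J s m" "J m t"] by (simp add: J_def)
  ultimately have "norm (J a b) \<le> 0 / (1 - 2 powr (1 - \<theta>)) * (b - a) powr \<theta>"
    using ab by (intro midpoint_bootstrap[OF \<theta> \<theta>, where T = "b + 1" and K = K]) auto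
  then show ?thesis using ab by (simp add: J_def clip_def)
qed

lemma close_multiplicative_unique:
  fixes u v \<mu> :: "real \<Rightarrow> real \<Rightarrow> 'a::real_normed_algebra_1"
  assumes s: "1 < s"
    and u: "multiplicative_on T u" "close_of_order T s u \<mu>"
    and v: "multiplicative_on T v" "close_of_order T s v \<mu>"
    and \<mu>: "\<And>a b. 0 \<le> a \<Longrightarrow> a \<le> b \<Longrightarrow> b < T \<Longrightarrow> norm (\<mu> a b) \<le> L"
    and ab: "0 \<le> a" "a \<le> b" "b < T"
  shows "v a b = u a b"
proof -
  have bound: "\<exists>C\<ge>0. \<forall>a b. 0 \<le> a \<and> a \<le> b \<and> b < T \<longrightarrow> norm (w a b - \<mu> a b) \<le> C * (b - a) powr s"
    if "close_of_order T s w \<mu>" for w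
  proof -
    obtain C where C: "\<And>a b. 0 \<le> a \<and> a \<le> b \<and> b < T \<longrightarrow> norm (w a b - \<mu> a b) \<le> C * \<bar>b - a\<bar> powr s"
      using \<open>close_of_order T s w \<mu>\<close> unfolding close_of_order_def by blast
    show ?thesis
    proof (intro exI[of _ "\<bar>C\<bar>"] conjI allI impI)
      fix a b assume ab: "0 \<le> a \<and> a \<le> b \<and> b < T"
      have "norm (w a b - \<mu> a b) \<le> C * (b - a) powr s" using C[of a b] ab by simp
      also have "\<dots> \<le> \<bar>C\<bar> * (b - a) powr s" by (intro mult_right_mono) auto
      finally show "norm (w a b - \<mu> a b) \<le> \<bar>C\<bar> * (b - a) powr s" .
    qed simp
  qed
  obtain Cu where Cu: "0 \<le> Cu"
    "\<And>a b. 0 \<le> a \<Longrightarrow> a \<le> b \<Longrightarrow> b < T \<Longrightarrow> norm (u a b - \<mu> a b) \<le> Cu * (b - a) powr s"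
    using bound[OF u(2)] by blast
  obtain Cv where Cv: "0 \<le> Cv"
    "\<And>a b. 0 \<le> a \<Longrightarrow> a \<le> b \<Longrightarrow> b < T \<Longrightarrow> norm (v a b - \<mu> a b) \<le> Cv * (b - a) powr s"
    using bound[OF v(2)] by blast
  define N where "N = \<bar>L\<bar> + (Cu + Cv) * T powr s"
  have le: "C * (b - a) powr s \<le> (Cu + Cv) * T powr s"
    if "0 \<le> a" "a \<le> b" "b < T" "0 \<le> C" "C \<le> Cu + Cv" for a b C
    using that s by (intro mult_mono powr_mono2) auto
  have Nu: "norm (u a b) \<le> N" if "0 \<le> a" "a \<le> b" "b < T" for a b
    using Cu(2)[OF that] \<mu>[OF that] le[OF that Cu(1)] Cv(1) norm_triangle_sub[of "u a b" "\<mu> a b"]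
    unfolding N_def by linarith
  have Nv: "norm (v a b) \<le> N" if "0 \<le> a" "a \<le> b" "b < T" for a b
    using Cv(2)[OF that] \<mu>[OF that] le[OF that Cv(1)] Cu(1) norm_triangle_sub[of "v a b" "\<mu> a b"]
    unfolding N_def by linarith
  have N: "0 \<le> N" using norm_ge_zero[of "u a b"] Nu[OF ab] by linarith
  have um: "u a b = u a c * u c b" and vm: "v a b = v a c * v c b"
    if "0 \<le> a" "a \<le> c" "c \<le> b" "b < T" for a c b
    using that u(1) v(1) unfolding multiplicative_on_def by blast+
  define w where "w t = u a t * v t b" for t
  have "norm (w t - w r) \<le> N * (Cu + Cv) * N * (t - r) powr s"
    if rt: "a \<le> r" "r \<le> t" "t \<le> b" for r t
  proof -
    have "w t - w r = u a r * (u r t - v r t) * v t b"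
      using um[of a r t] vm[of r t b] ab rt by (simp add: w_def algebra_simps)
    moreover have "norm (u r t - v r t) \<le> (Cu + Cv) * (t - r) powr s"
    proof -
      have "norm (u r t - v r t) \<le> norm (u r t - \<mu> r t) + norm (v r t - \<mu> r t)"
        using norm_triangle_ineq4[of "u r t - \<mu> r t" "v r t - \<mu> r t"] by simp
      then show ?thesis using Cu(2)[of r t] Cv(2)[of r t] ab rt by (simp add: distrib_right)
    qed
    ultimately have "norm (w t - w r) \<le> N * ((Cu + Cv) * (t - r) powr s) * N"
      using ab rt N Cu(1) Cv(1) Nu[of a r] Nv[of t b]
      by (auto intro!: order_trans[OF norm_mult_ineq] mult_mono)
    then show ?thesis by (simp add: mult_ac)
  qed
  then have "w b = w a"
    using s N Cu(1) Cv(1) ab by (intro superlinear_imp_eq[of s "N * (Cu + Cv) * N"]) auto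
  \<comment> \<open>On the diagonal both functions agree with \<open>\<mu>\<close>, since \<open>0 powr s = 0\<close>.\<close>
  moreover have "w b = u a b"
  proof -
    have "u b b = v b b" using Cu(2)[of b b] Cv(2)[of b b] ab by simp
    then show ?thesis using um[of a b b] ab by (simp add: w_def)
  qed
  moreover have "w a = v a b"
  proof -
    have "u a a = v a a" using Cu(2)[of a a] Cv(2)[of a a] ab by simp
    then show ?thesis using vm[of a a b] ab by (simp add: w_def)
  qed
  ultimately show ?thesis by simp
qed

section \<open>Infinite radius of convergence\<close>

lemma truncated_Cauchy_product_le:
  fixes x y :: "nat \<Rightarrow> real"
  assumes "\<And>i. 0 \<le> x i" "\<And>i. 0 \<le> y i"
  shows "(\<Sum>k\<le>K. \<Sum>i\<le>k. x i * y (k - i)) \<le> (\<Sum>k\<le>K. x k) * (\<Sum>k\<le>K. y k)"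
proof -
  have "(\<Sum>k\<le>K. \<Sum>i\<le>k. x i * y (k - i)) = (\<Sum>(i, j) \<in> {(i, j). i + j \<le> K}. x i * y j)"
    by (simp add: sum.triangle_reindex_eq)
  also have "\<dots> \<le> (\<Sum>(i, j) \<in> {..K} \<times> {..K}. x i * y j)"
    using assms by (intro sum_mono2) auto
  also have "\<dots> = (\<Sum>k\<le>K. x k) * (\<Sum>k\<le>K. y k)"
    by (simp add: sum_product sum.cartesian_product)
  finally show ?thesis .
qed

text \<open>
  For intervals of length at most \<open>h\<close>, with \<open>R * \<rho> * h powr \<alpha> \<le> 1 / 2\<close>, the terms are dominated by a
  geometric series and the power of \<open>b - a\<close> can be read off.  On longer intervals \<open>b - a\<close> is bounded
  below, so a uniform bound suffices.  It comes from the truncated norm series \<open>Q K a b\<close>: these are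
  submultiplicative under concatenation of intervals, at most \<open>2\<close> on short ones, and boundedly many
  short intervals make up any \<open>[a, b]\<close>.  Truncating at \<open>K\<close> avoids presupposing convergence.
\<close>

lemma extension_decay:
  fixes X :: "nat \<Rightarrow> real \<Rightarrow> real \<Rightarrow> 'a::real_normed_algebra_1"
  assumes \<alpha>: "0 < \<alpha>" and \<rho>: "0 \<le> \<rho>" and R: "0 \<le> R"
    and one: "\<And>a b. 0 \<le> a \<Longrightarrow> a \<le> b \<Longrightarrow> b < T \<Longrightarrow> X 0 a b = 1"
    and chen: "\<And>k a c b. 0 \<le> a \<Longrightarrow> a \<le> c \<Longrightarrow> c \<le> b \<Longrightarrow> b < T \<Longrightarrow>
        X k a b = (\<Sum>i=0..k. X i a c * X (k - i) c b)"
    and bound: "\<And>k a b. 0 < k \<Longrightarrow> 0 \<le> a \<Longrightarrow> a \<le> b \<Longrightarrow> b < T \<Longrightarrow>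
        norm (X k a b) \<le> (\<rho> * (b - a) powr \<alpha>) ^ k"
  obtains D where "0 \<le> D"
    "\<And>k a b. n < k \<Longrightarrow> 0 \<le> a \<Longrightarrow> a \<le> b \<Longrightarrow> b < T \<Longrightarrow>
        R ^ k * norm (X k a b) \<le> D * ((b - a) powr \<alpha>) ^ Suc n"
proof -
  define h where "h = (1 / (2 * (R * \<rho> + 1))) powr (1 / \<alpha>)"
  have R\<rho>: "0 \<le> R * \<rho>" using R \<rho> by simp
  have h: "0 < h" using R\<rho> by (simp add: h_def)
  have "h powr \<alpha> = 1 / (2 * (R * \<rho> + 1))"
    using R\<rho> \<alpha> by (simp add: h_def powr_powr)
  then have "R * \<rho> * h powr \<alpha> = (R * \<rho>) / (2 * (R * \<rho> + 1))" by simp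
  also have "\<dots> \<le> 1 / 2" using R\<rho> by (subst divide_le_eq) auto
  finally have half: "R * \<rho> * h powr \<alpha> \<le> 1 / 2" .
  have short_y: "0 \<le> R * \<rho> * (b - a) powr \<alpha>" "R * \<rho> * (b - a) powr \<alpha> \<le> 1 / 2"
    if "a \<le> b" "b - a \<le> h" for a b
  proof -
    have "R * \<rho> * (b - a) powr \<alpha> \<le> R * \<rho> * h powr \<alpha>"
      using that \<alpha> R\<rho> by (intro mult_left_mono powr_mono2) auto
    then show "R * \<rho> * (b - a) powr \<alpha> \<le> 1 / 2" using half by linarith
  qed (use R\<rho> in simp)
  have term_le: "R ^ k * norm (X k a b) \<le> (R * \<rho> * (b - a) powr \<alpha>) ^ k"
    if "0 \<le> a" "a \<le> b" "b < T" for k a b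
  proof (cases "k = 0")
    case True
    then show ?thesis using one[OF that] by simp
  next
    case False
    then show ?thesis
      using mult_left_mono[OF bound[OF _ that, of k], of "R ^ k"] R
      by (simp add: power_mult_distrib mult_ac)
  qed
  define Q where "Q K a b = (\<Sum>k\<le>K. R ^ k * norm (X k a b))" for K :: nat and a b
  have Q0: "0 \<le> Q K a b" for K a b using R by (auto simp: Q_def intro!: sum_nonneg)
  have Q_short: "Q K a b \<le> 2" if "0 \<le> a" "a \<le> b" "b < T" "b - a \<le> h" for K a b
  proof -
    have "Q K a b \<le> (\<Sum>k\<le>K. (1 / 2) ^ k)"
      unfolding Q_def using short_y[OF that(2,4)] that
      by (intro sum_mono order_trans[OF term_le] power_mono) auto
    also have "\<dots> \<le> (\<Sum>k. (1 / 2 :: real) ^ k)"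
      by (intro sum_le_suminf summable_geometric) auto
    also have "\<dots> = 2" by (simp add: suminf_geometric)
    finally show ?thesis .
  qed
  have Q_mult: "Q K a b \<le> Q K a c * Q K c b"
    if "0 \<le> a" "a \<le> c" "c \<le> b" "b < T" for K a c b
  proof -
    have "R ^ k * norm (X k a b)
        \<le> (\<Sum>i\<le>k. (R ^ i * norm (X i a c)) * (R ^ (k - i) * norm (X (k - i) c b)))" for k
    proof -
      have "norm (X k a b) \<le> (\<Sum>i\<le>k. norm (X i a c) * norm (X (k - i) c b))"
        unfolding chen[OF that] atMost_atLeast0[symmetric]
        by (intro sum_norm_le norm_mult_ineq)
      then have "R ^ k * norm (X k a b) \<le> R ^ k * (\<Sum>i\<le>k. norm (X i a c) * norm (X (k - i) c b))"
        using R by (intro mult_left_mono) auto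
      also have "\<dots> = (\<Sum>i\<le>k. (R ^ i * R ^ (k - i)) * (norm (X i a c) * norm (X (k - i) c b)))"
        unfolding sum_distrib_left by (intro sum.cong) (simp_all flip: power_add)
      finally show ?thesis by (simp add: mult_ac)
    qed
    then have "Q K a b
        \<le> (\<Sum>k\<le>K. \<Sum>i\<le>k. (R ^ i * norm (X i a c)) * (R ^ (k - i) * norm (X (k - i) c b)))"
      unfolding Q_def by (rule sum_mono)
    also have "\<dots> \<le> Q K a c * Q K c b"
      unfolding Q_def using R by (intro truncated_Cauchy_product_le) auto
    finally show ?thesis .
  qed
  have Q_chop: "Q K a b \<le> 2 ^ Suc m"
    if "0 \<le> a" "a \<le> b" "b < T" "b - a \<le> real (Suc m) * h" for K m a b
    using that
  proof (induction m arbitrary: a)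
    case 0
    then show ?case using Q_short by simp
  next
    case (Suc m)
    show ?case
    proof (cases "b - a \<le> h")
      case True
      have "Q K a b \<le> 2 ^ 1" using Q_short[OF Suc.prems(1-3) True] by simp
      also have "\<dots> \<le> 2 ^ Suc (Suc m)" by (rule power_increasing) auto
      finally show ?thesis .
    next
      case False
      then have "Q K a b \<le> Q K a (a + h) * Q K (a + h) b"
        using Suc.prems h by (intro Q_mult) auto
      also have "\<dots> \<le> 2 * 2 ^ Suc m"
        using Suc.prems h False
        by (intro mult_mono Q_short Suc.IH Q0) (auto simp: algebra_simps)
      finally show ?thesis by simp
    qed
  qed
  obtain m where m: "T / h < real m" using reals_Archimedean2 by blast
  have "T \<le> real m * h" using m h by (simp add: field_simps)
  also have "\<dots> \<le> real (Suc m) * h" using h by simp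
  finally have Tm: "T \<le> real (Suc m) * h" .
  have long: "R ^ k * norm (X k a b) \<le> 2 ^ Suc m"
    if "0 \<le> a" "a \<le> b" "b < T" for k a b
  proof -
    have "R ^ k * norm (X k a b) \<le> Q k a b"
      unfolding Q_def using R by (intro member_le_sum) auto
    then show ?thesis using Q_chop[OF that, of m k] that Tm by linarith
  qed
  define D where "D = (R * \<rho>) ^ Suc n + 2 ^ Suc m / (h powr \<alpha>) ^ Suc n"
  have D: "(R * \<rho>) ^ Suc n \<le> D" "2 ^ Suc m / (h powr \<alpha>) ^ Suc n \<le> D"
    using R\<rho> by (auto simp: D_def simp del: power_Suc)
  have D0: "0 \<le> D" using R\<rho> by (simp add: D_def del: power_Suc)
  show ?thesis
  proof (rule that[OF D0])
    fix k a b assume k: "n < k" and ab: "0 \<le> a" "a \<le> b" "b < T"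
    show "R ^ k * norm (X k a b) \<le> D * ((b - a) powr \<alpha>) ^ Suc n"
    proof (cases "b - a \<le> h")
      case True
      have "R ^ k * norm (X k a b) \<le> (R * \<rho> * (b - a) powr \<alpha>) ^ k" by (rule term_le[OF ab])
      also have "\<dots> \<le> (R * \<rho> * (b - a) powr \<alpha>) ^ Suc n"
        using short_y[OF ab(2) True] k by (intro power_decreasing) auto
      also have "\<dots> = (R * \<rho>) ^ Suc n * ((b - a) powr \<alpha>) ^ Suc n"
        by (rule power_mult_distrib)
      also have "\<dots> \<le> D * ((b - a) powr \<alpha>) ^ Suc n"
        using D(1) by (rule mult_right_mono) simp
      finally show ?thesis .
    next
      case False
      have "R ^ k * norm (X k a b) \<le> 2 ^ Suc m" by (rule long[OF ab])
      also have "\<dots> = 2 ^ Suc m / (h powr \<alpha>) ^ Suc n * (h powr \<alpha>) ^ Suc n"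
        using h by simp
      also have "\<dots> \<le> D * ((b - a) powr \<alpha>) ^ Suc n"
        using False h \<alpha> ab D0 D by (intro mult_mono power_mono powr_mono2) auto
      finally show ?thesis .
    qed
  qed
qed

section \<open>Existence, uniqueness and expansion\<close>

theorem mainTheorem5:
  fixes A :: "nat \<Rightarrow> real \<Rightarrow> real \<Rightarrow> 'a::{real_normed_algebra_1, banach}"
    and T \<alpha> M :: real and n :: nat
  assumes "0 < T"
    and "\<alpha> > 1 / (real n + 1)"
    and "multiplicative_family T n \<alpha> M A"
  shows
    "(\<forall>lam::real. \<exists>u.
        multiplicative_on T u \<and>
        close_of_order T ((real n + 1) * \<alpha>) u (truncated_sum n A lam) \<and>
        (\<forall>v. multiplicative_on T v \<and>
             close_of_order T ((real n + 1) * \<alpha>) v (truncated_sum n A lam) \<longrightarrow>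
             (\<forall>a b. 0 \<le> a \<and> a \<le> b \<and> b < T \<longrightarrow> v a b = u a b))) \<and>
     (\<exists>B :: nat \<Rightarrow> real \<Rightarrow> real \<Rightarrow> 'a. \<forall>(lam::real) u.
        multiplicative_on T u \<and>
        close_of_order T ((real n + 1) * \<alpha>) u (truncated_sum n A lam) \<longrightarrow>
        normally_convergent_on (ordered_pairs T)
          (\<lambda>j (a, b). lam ^ (j + (n + 1)) *\<^sub>R B (j + (n + 1)) a b) \<and>
        (\<forall>a b. 0 \<le> a \<and> a \<le> b \<and> b < T \<longrightarrow>
           u a b = (\<Sum>k=0..n. lam ^ k *\<^sub>R A k a b)
                 + (\<Sum>j. lam ^ (j + (n + 1)) *\<^sub>R B (j + (n + 1)) a b)))"
proof -
  have T: "0 < T" by fact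
  define s where "s = (real n + 1) * \<alpha>"
  have s: "1 < s" using assms(2) by (simp add: s_def field_simps)
  have \<alpha>: "0 < \<alpha>" using assms(2) by (smt (verit) divide_nonneg_nonneg of_nat_0_le_iff)
  have s_powr: "(x powr \<alpha>) ^ Suc n = x powr s" if "0 \<le> x" for x
    using that by (subst powr_power_pos) (auto simp: s_def add.commute)
  show ?thesis
  proof (rule full_extension[OF T s[unfolded s_def] assms(3)])
    fix \<rho> and X :: "nat \<Rightarrow> real \<Rightarrow> real \<Rightarrow> 'a"
    assume \<rho>: "0 \<le> \<rho>" and XA: "\<And>k. k \<le> n \<Longrightarrow> X k = A k"
      and chen: "\<And>k a c b. 0 \<le> a \<Longrightarrow> a \<le> c \<Longrightarrow> c \<le> b \<Longrightarrow> b < T \<Longrightarrow>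
          X k a b = (\<Sum>i=0..k. X i a c * X (k - i) c b)"
      and bound: "\<And>k a b. 0 < k \<Longrightarrow> 0 \<le> a \<Longrightarrow> a \<le> b \<Longrightarrow> b < T \<Longrightarrow>
          norm (X k a b) \<le> (\<rho> * (b - a) powr \<alpha>) ^ k"
    have one: "X 0 a b = 1" if "0 \<le> a" "a \<le> b" "b < T" for a b
      using that assms(3) XA[of 0] by (auto simp: multiplicative_family_def)
    have A_bound: "norm (A k a b) \<le> M * (T powr \<alpha>) ^ k"
      if "k \<le> n" "0 \<le> a" "a \<le> b" "b < T" for k a b
    proof -
      have A_le: "norm (A k a b) \<le> M * ((b - a) powr \<alpha>) ^ k" if "k \<le> n" "0 \<le> a" "a \<le> b" "b < T" for k a b
        using assms(3) that unfolding multiplicative_family_def by (metis abs_of_nonneg diff_ge_0_iff_ge)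
      have "0 \<le> M" using order_trans[OF norm_ge_zero A_le[of 0 0 0]] T by simp
      then have "M * ((b - a) powr \<alpha>) ^ k \<le> M * (T powr \<alpha>) ^ k"
        using that \<alpha> by (intro mult_left_mono power_mono powr_mono2) auto
      then show ?thesis using A_le[OF that] by linarith
    qed
    have geo: "(\<lambda>j. E * (1 / 2) ^ j) sums (E * 2)" for E :: real
      using sums_mult[OF geometric_sums[of "1 / 2 :: real"], of E] by simp
    \<comment> \<open>Applying the decay estimate at \<open>2 * \<bar>lam\<bar>\<close> leaves a geometric factor for summation in \<open>j\<close>.\<close>
    have "\<forall>lam. \<exists>D. 0 \<le> D \<and> (\<forall>j a b. 0 \<le> a \<longrightarrow> a \<le> b \<longrightarrow> b < T \<longrightarrow>
        norm (lam ^ (j + (n + 1)) *\<^sub>R X (j + (n + 1)) a b) \<le> D * (b - a) powr s * (1 / 2) ^ j)"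
    proof
      fix lam
      obtain D where D: "0 \<le> D" and le: "\<And>k a b. n < k \<Longrightarrow> 0 \<le> a \<Longrightarrow> a \<le> b \<Longrightarrow> b < T \<Longrightarrow>
          (2 * \<bar>lam\<bar>) ^ k * norm (X k a b) \<le> D * ((b - a) powr \<alpha>) ^ Suc n"
        using extension_decay[OF \<alpha> \<rho> _ one chen bound, of "2 * \<bar>lam\<bar>"] by auto
      have "norm (lam ^ k *\<^sub>R X k a b) \<le> D * (b - a) powr s * (1 / 2) ^ j"
        if k: "k = j + (n + 1)" and ab: "0 \<le> a" "a \<le> b" "b < T" for j k a b
      proof -
        have "norm (lam ^ k *\<^sub>R X k a b) = (2 * \<bar>lam\<bar>) ^ k * norm (X k a b) * (1 / 2) ^ k"
          by (simp add: power_mult_distrib power_abs power_divide)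
        also have "\<dots> \<le> D * ((b - a) powr \<alpha>) ^ Suc n * (1 / 2) ^ k"
          using le[of k a b] ab k by (intro mult_right_mono) auto
        also have "\<dots> \<le> D * ((b - a) powr \<alpha>) ^ Suc n * (1 / 2) ^ j"
          using D k by (intro mult_left_mono power_decreasing) auto
        finally show ?thesis using ab by (simp only: s_powr diff_ge_0_iff_ge)
      qed
      then show "\<exists>D. 0 \<le> D \<and> (\<forall>j a b. 0 \<le> a \<longrightarrow> a \<le> b \<longrightarrow> b < T \<longrightarrow>
        norm (lam ^ (j + (n + 1)) *\<^sub>R X (j + (n + 1)) a b) \<le> D * (b - a) powr s * (1 / 2) ^ j)"
        using D by (intro exI[of _ D]) simp
    qed
    from choice[OF this] obtain D where "\<forall>lam. 0 \<le> D lam \<and> (\<forall>j a b. 0 \<le> a \<longrightarrow> a \<le> b \<longrightarrow> b < T \<longrightarrow>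
        norm (lam ^ (j + (n + 1)) *\<^sub>R X (j + (n + 1)) a b) \<le> D lam * (b - a) powr s * (1 / 2) ^ j)" ..
    then have D0: "0 \<le> D lam" and tail_bound: "0 \<le> a \<Longrightarrow> a \<le> b \<Longrightarrow> b < T \<Longrightarrow>
        norm (lam ^ (j + (n + 1)) *\<^sub>R X (j + (n + 1)) a b) \<le> D lam * (b - a) powr s * (1 / 2) ^ j"
      for lam a b j by simp_all
    define U where "U lam a b = (\<Sum>k. lam ^ k *\<^sub>R X k a b)" for lam a b
    have summable: "summable (\<lambda>k. norm (lam ^ k *\<^sub>R X k a b))" if "0 \<le> a" "a \<le> b" "b < T" for lam a b
    proof -
      have "summable (\<lambda>j. norm (lam ^ (j + (n + 1)) *\<^sub>R X (j + (n + 1)) a b))"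
        by (rule summable_comparison_test'[OF sums_summable[OF geo], of 0])
          (use tail_bound[OF that] in simp)
      then show ?thesis by (rule summable_iff_shift[THEN iffD1])
    qed
    have U_split: "U lam a b = truncated_sum n A lam a b + (\<Sum>j. lam ^ (j + (n + 1)) *\<^sub>R X (j + (n + 1)) a b)"
      if "0 \<le> a" "a \<le> b" "b < T" for lam a b
    proof -
      have "(\<Sum>k<n + 1. lam ^ k *\<^sub>R X k a b) = truncated_sum n A lam a b"
        unfolding truncated_sum_def by (intro sum.cong) (auto simp: XA)
      then show ?thesis
        using suminf_split_initial_segment[OF summable_norm_cancel[OF summable[OF that]], of lam "n + 1"]
        by (simp add: U_def add.commute)
    qed
    have U_mult: "multiplicative_on T (U lam)" for lam
      unfolding multiplicative_on_def
    proof (intro allI impI)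
      fix a c b assume ac: "0 \<le> a \<and> a \<le> c \<and> c \<le> b \<and> b < T"
      have "U lam a c * U lam c b
          = (\<Sum>k. \<Sum>i\<le>k. (lam ^ i *\<^sub>R X i a c) * (lam ^ (k - i) *\<^sub>R X (k - i) c b))"
        unfolding U_def using ac by (intro Cauchy_product summable) auto
      also have "\<dots> = (\<Sum>k. lam ^ k *\<^sub>R X k a b)"
      proof (intro suminf_cong)
        fix k
        have "(\<Sum>i\<le>k. (lam ^ i *\<^sub>R X i a c) * (lam ^ (k - i) *\<^sub>R X (k - i) c b))
            = (\<Sum>i\<le>k. lam ^ k *\<^sub>R (X i a c * X (k - i) c b))"
          by (intro sum.cong) (simp_all flip: power_add)
        then show "(\<Sum>i\<le>k. (lam ^ i *\<^sub>R X i a c) * (lam ^ (k - i) *\<^sub>R X (k - i) c b))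
            = lam ^ k *\<^sub>R X k a b"
          using chen[of a c b k] ac by (simp add: scaleR_sum_right atMost_atLeast0)
      qed
      finally show "U lam a b = U lam a c * U lam c b" by (simp add: U_def)
    qed
    have U_close: "close_of_order T s (U lam) (truncated_sum n A lam)" for lam
    proof -
      have "norm (U lam a b - truncated_sum n A lam a b) \<le> 2 * D lam * \<bar>b - a\<bar> powr s"
        if ab: "0 \<le> a" "a \<le> b" "b < T" for a b
      proof -
        let ?g = "\<lambda>j. D lam * (b - a) powr s * (1 / 2 :: real) ^ j"
        have "norm (\<Sum>j. lam ^ (j + (n + 1)) *\<^sub>R X (j + (n + 1)) a b) \<le> suminf ?g"
          by (rule norm_suminf_le[OF tail_bound[OF ab] sums_summable[OF geo]])
        also have "suminf ?g = D lam * (b - a) powr s * 2"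
          by (rule sums_unique[OF geo, symmetric])
        finally show ?thesis using U_split[OF ab] ab by simp
      qed
      then show ?thesis unfolding close_of_order_def by blast
    qed
    have unique: "v a b = U lam a b"
      if v: "multiplicative_on T v" "close_of_order T s v (truncated_sum n A lam)"
        and ab: "0 \<le> a" "a \<le> b" "b < T" for v lam a b
    proof (rule close_multiplicative_unique[OF s U_mult U_close v _ ab])
      fix a b assume ab: "0 \<le> a" "a \<le> b" "b < T"
      show "norm (truncated_sum n A lam a b) \<le> (\<Sum>k=0..n. \<bar>lam\<bar> ^ k * (M * (T powr \<alpha>) ^ k))"
        unfolding truncated_sum_def using A_bound[OF _ ab]
        by (intro sum_norm_le) (auto simp: power_abs intro!: mult_left_mono)
    qed
    have normal: "normally_convergent_on (ordered_pairs T)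
        (\<lambda>j (a, b). lam ^ (j + (n + 1)) *\<^sub>R X (j + (n + 1)) a b)" for lam
    proof -
      let ?f = "\<lambda>j (a, b). lam ^ (j + (n + 1)) *\<^sub>R X (j + (n + 1)) a b"
      have le: "norm (?f j p) \<le> D lam * T powr s * (1 / 2) ^ j" if "p \<in> ordered_pairs T" for j p
      proof -
        obtain a b where p: "p = (a, b)" and ab: "0 \<le> a" "a \<le> b" "b < T"
          using \<open>p \<in> ordered_pairs T\<close> by (cases p) (auto simp: ordered_pairs_def)
        have "D lam * (b - a) powr s * (1 / 2) ^ j \<le> D lam * T powr s * (1 / 2) ^ j"
          using D0 ab s by (intro mult_right_mono mult_left_mono powr_mono2) auto
        then show ?thesis unfolding p using tail_bound[OF ab, of lam j] by simp
      qed
      have bdd: "bdd_above ((\<lambda>p. norm (?f j p)) ` ordered_pairs T)" for j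
        by (rule bdd_aboveI2[OF le])
      have mem: "(0, 0) \<in> ordered_pairs T" using T by (simp add: ordered_pairs_def)
      have "norm (SUP p\<in>ordered_pairs T. norm (?f j p)) \<le> D lam * T powr s * (1 / 2) ^ j" for j
      proof -
        have "(SUP p\<in>ordered_pairs T. norm (?f j p)) \<le> D lam * T powr s * (1 / 2) ^ j"
          using mem le by (intro cSUP_least) auto
        moreover have "0 \<le> (SUP p\<in>ordered_pairs T. norm (?f j p))"
          by (rule order_trans[OF norm_ge_zero cSUP_upper[OF mem bdd]])
        ultimately show ?thesis by simp
      qed
      then have "summable (\<lambda>j. SUP p\<in>ordered_pairs T. norm (?f j p))"
        by (intro summable_comparison_test'[OF sums_summable[OF geo], of 0]) auto
      then show ?thesis using bdd unfolding normally_convergent_on_def by blast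
    qed
    show ?thesis
      unfolding s_def[symmetric]
    proof (intro conjI allI exI[of _ X] impI)
      fix lam
      show "\<exists>u. multiplicative_on T u \<and> close_of_order T s u (truncated_sum n A lam) \<and>
          (\<forall>v. multiplicative_on T v \<and> close_of_order T s v (truncated_sum n A lam) \<longrightarrow>
            (\<forall>a b. 0 \<le> a \<and> a \<le> b \<and> b < T \<longrightarrow> v a b = u a b))"
        using U_mult U_close unique by blast
    next
      fix lam u a b
      assume "multiplicative_on T u \<and> close_of_order T s u (truncated_sum n A lam)"
        and ab: "0 \<le> a \<and> a \<le> b \<and> b < T"
      then have "u a b = U lam a b" using unique by blast
      then show "u a b = (\<Sum>k=0..n. lam ^ k *\<^sub>R A k a b)
          + (\<Sum>j. lam ^ (j + (n + 1)) *\<^sub>R X (j + (n + 1)) a b)"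
        using U_split[of a b lam] ab by (simp add: truncated_sum_def)
    qed (rule normal)
  qed
qed

end
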